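(* Let $0^{s_1}1^{t_1}\cdots0^{s_k}1^{t_k}$ be the binary string of a connected threshold graph $\Gamma$. Then, for each $i$ with $t_i>1$, the number $-\frac{1}{t+S_i-1}$ is an eigenvalue of $\mathcal{A}$ of multiplicity at least $t_i-1$.
   Context: Binary strings: a threshold graph with binary string $b=b_1\ldots b_n$ (where $b_1=0$) is the simple graph on vertices $1,\dots,n$ built by adding vertices in order, vertex $i\ge 2$ being added as an isolated vertex if $b_i=0$ and as a dominating vertex (adjacent to all earlier vertices) if $b_i=1$. A connected threshold graph on $n\ge 2$ vertices has $b_n=1$, and its string is written $0^{s_1}1^{t_1}\cdots0^{s_k}1^{t_k}$ with $k\ge1$ and all $s_i,t_i$ positive integers. Put $t=\sum_i t_i$ and $S_i=\sum_{j\le i}s_j$. The normalized adjacency matrix of $\Gamma$ is $\mathcal{A}=D^{-1}A$, where $A$ is the adjacency matrix and $D$ the diagonal matrix of vertex degrees. *)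

theory Defs
  imports
    "Jordan_Normal_Form.Jordan_Normal_Form_Uniqueness"
    "Jordan_Normal_Form.Gauss_Jordan_Elimination"
    "Graph_Theory.Graph_Theory"
begin

text \<open>
  A simple graph is a \<open>pair_pre_digraph\<close> satisfying \<open>pair_graph\<close>: finite, loop-free, and with
  each undirected edge represented by its two opposite arcs.
\<close>

definition add_isolated :: "'a \<Rightarrow> 'a pair_pre_digraph \<Rightarrow> 'a pair_pre_digraph" where
  "add_isolated v G = \<lparr>pverts = insert v (pverts G), parcs = parcs G\<rparr>"

definition add_dominating :: "'a \<Rightarrow> 'a pair_pre_digraph \<Rightarrow> 'a pair_pre_digraph" where
  "add_dominating v G = \<lparr>pverts = insert v (pverts G),
     parcs = parcs G \<union> ({v} \<times> pverts G) \<union> (pverts G \<times> {v})\<rparr>"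

text \<open>
  Binary strings are Boolean lists, with \<open>True\<close> for 1 and \<open>False\<close> for 0. Lists are indexed from 0,
  so the entry of vertex \<open>Suc i\<close> is \<open>b ! i\<close>. The entry of vertex 1 is immaterial to the graph.
\<close>

primrec threshold_graph_upto :: "bool list \<Rightarrow> nat \<Rightarrow> nat pair_pre_digraph" where
  "threshold_graph_upto b 0 = \<lparr>pverts = {}, parcs = {}\<rparr>"
| "threshold_graph_upto b (Suc i) =
     (if b ! i then add_dominating (Suc i) (threshold_graph_upto b i)
      else add_isolated (Suc i) (threshold_graph_upto b i))"

definition threshold_graph :: "bool list \<Rightarrow> nat pair_pre_digraph" where
  "threshold_graph b = threshold_graph_upto b (length b)"

definition block_string :: "nat \<Rightarrow> (nat \<Rightarrow> nat) \<Rightarrow> (nat \<Rightarrow> nat) \<Rightarrow> bool list" where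
  "block_string k s t =
     concat (map (\<lambda>i. replicate (s i) False @ replicate (t i) True) [1..<Suc k])"

text \<open>
  The matrices below are for graphs with vertex set \<open>{1..n}\<close>; row and column \<open>i\<close> (counted from 0)
  belong to vertex \<open>Suc i\<close>.
\<close>

definition adjacency_matrix :: "nat pair_pre_digraph \<Rightarrow> real mat" where
  "adjacency_matrix G = (let n = card (pverts G) in
     mat n n (\<lambda>(i, j). if (Suc i, Suc j) \<in> parcs G then 1 else 0))"

definition degree_matrix :: "nat pair_pre_digraph \<Rightarrow> real mat" where
  "degree_matrix G = mat_diag (card (pverts G)) (\<lambda>i. real (out_degree (with_proj G) (Suc i)))"

text \<open>
  \<open>mat_inverse\<close> returns \<open>None\<close> on singular matrices, so this is meaningful only for graphs
  without isolated vertices.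
\<close>

definition normalized_adjacency_matrix :: "nat pair_pre_digraph \<Rightarrow> real mat" where
  "normalized_adjacency_matrix G = the (mat_inverse (degree_matrix G)) * adjacency_matrix G"

lemma pverts_threshold_graph_upto: "pverts (threshold_graph_upto b m) = {1..m}"
  by (induction m) (auto simp: add_isolated_def add_dominating_def)

lemma parcs_threshold_graph_upto:
  "(u, v) \<in> parcs (threshold_graph_upto b m) \<longleftrightarrow>
     u \<in> {1..m} \<and> v \<in> {1..m} \<and> u \<noteq> v \<and> b ! (max u v - 1)"
proof (induction m arbitrary: u v)
  case (Suc m)
  consider "u = Suc m" | "u \<noteq> Suc m" "v = Suc m" | "u \<noteq> Suc m" "v \<noteq> Suc m" by blast
  then show ?case
    by cases (auto simp: Suc add_isolated_def add_dominating_def pverts_threshold_graph_upto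
        max_def)
qed simp

lemma pair_graph_threshold_graph: "pair_graph (threshold_graph b)"
proof
  show "finite (parcs (threshold_graph b))"
    by (rule finite_subset[of _ "{1..length b} \<times> {1..length b}"])
      (auto simp: threshold_graph_def parcs_threshold_graph_upto)
qed (auto simp: threshold_graph_def pverts_threshold_graph_upto parcs_threshold_graph_upto
    arcs_ends_conv symmetric_def sym_def max.commute)

lemma connected_threshold_graph:
  assumes "b \<noteq> []" "last b"
  shows "Digraph_Component.connected (with_proj (threshold_graph b))"
proof -
  define n where "n = length b"
  let ?H = "with_proj (mk_symmetric (with_proj (threshold_graph b)))"
  have n: "n > 0" and bn: "b ! (n - 1)"
    using assms by (auto simp: n_def last_conv_nth)
  have verts: "verts ?H = {1..n}"
    by (simp add: mk_symmetric_def threshold_graph_def pverts_threshold_graph_upto n_def)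
  have arcs: "arcs_ends ?H = parcs (threshold_graph b)"
    by (auto simp: mk_symmetric_def threshold_graph_def parcs_threshold_graph_upto max.commute)
  interpret H: wf_digraph ?H
    by unfold_locales
      (auto simp: mk_symmetric_def threshold_graph_def parcs_threshold_graph_upto
        pverts_threshold_graph_upto)
  have *: "u \<rightarrow>\<^sup>*\<^bsub>?H\<^esub> n \<and> n \<rightarrow>\<^sup>*\<^bsub>?H\<^esub> u" if "u \<in> {1..n}" for u
  proof (cases "u = n")
    case True
    then show ?thesis using verts that by auto
  next
    case False
    have "(u, n) \<in> arcs_ends ?H" "(n, u) \<in> arcs_ends ?H"
      unfolding arcs using that False n bn
      by (auto simp: threshold_graph_def parcs_threshold_graph_upto n_def max_def)
    then show ?thesis by blast
  qed
  show ?thesis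
    unfolding Digraph_Component.connected_def strongly_connected_def verts
  proof (intro conjI ballI)
    show "{1..n} \<noteq> {}" using n by auto
    fix u v assume "u \<in> {1..n}" "v \<in> {1..n}"
    then show "u \<rightarrow>\<^sup>*\<^bsub>?H\<^esub> v" using * H.reachable_trans by blast
  qed
qed

end

theory Submission
  imports Defs
begin

text \<open>
  The vertices of one block of ones in the string are twins: they are adjacent to each other and have
  the same neighbours elsewhere. Such a vertex is adjacent to every other vertex except the isolated
  additions that come after it, so its degree \<open>d\<close> is the number of ones in the whole string plus
  the number of zeros before it, minus one for the vertex itself; for the \<open>i\<close>-th block, \<open>d = t + S\<^sub>i - 1\<close>.
  In \<open>\<A> + (1/d) I\<close> the diagonal entry of such a vertex becomes \<open>1/d\<close>, just what its twins
  have in that row, so the columns belonging to the block coincide. The differences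
  of unit vectors \<open>e\<^sub>u - e\<^sub>v\<close>, with \<open>v\<close> a fixed vertex of the block, therefore lie in the kernel of
  that matrix, and the block contributes one fewer than its size to the geometric multiplicity of
  \<open>-1/d\<close>: lemmas \<open>card_equal_columns_le_kernel_dim\<close> and \<open>kernel_dim_char_matrix_run_of_ones\<close>.

  The algebraic multiplicity is bounded from below by the geometric one over every field
  (\<open>kernel_dim_le_order_char_poly\<close>), and a positive geometric multiplicity gives the eigenvalue.
\<close>

section \<open>Geometric and algebraic multiplicity\<close>

text \<open>
  If the columns \<open>u\<close> and \<open>v\<close> coincide, then \<open>e\<^sub>u - e\<^sub>v\<close> is in the kernel. For fixed \<open>v\<close> these
  vectors are independent, since only \<open>e\<^sub>u - e\<^sub>v\<close> has a nonzero entry at position \<open>u\<close>.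
\<close>

lemma card_equal_columns_le_kernel_dim:
  fixes M :: "'a :: field mat"
  assumes M: "M \<in> carrier_mat nr nc"
    and U: "U \<subseteq> {..<nc}" and v: "v < nc" "v \<notin> U"
    and eq: "\<And>u. u \<in> U \<Longrightarrow> col M u = col M v"
  shows "card U \<le> kernel_dim M"
proof -
  interpret kernel nr nc M by unfold_locales (rule M)
  define w where "w u = unit_vec nc u - (unit_vec nc v :: 'a vec)" for u
  have finU: "finite U"
    using U finite_subset by blast
  have w_carrier: "w u \<in> carrier_vec nc" for u
    by (simp add: w_def)
  have w_index: "w u $ x = (if u = x then 1 else 0)" if "u \<in> U" "x \<in> U" for u x
    using that U v by (auto simp: w_def unit_vec_def)
  have inj: "inj_on w U"
    by (intro inj_onI) (metis w_index zero_neq_one)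
  have "M *\<^sub>v w u = 0\<^sub>v nr" if "u \<in> U" for u
  proof -
    have "M *\<^sub>v w u = M *\<^sub>v unit_vec nc u - M *\<^sub>v unit_vec nc v"
      unfolding w_def by (rule mult_minus_distrib_mat_vec[OF M]) auto
    also have "\<dots> = col M u - col M v"
      using that U v M by (auto intro!: eq_vecI)
    also have "\<dots> = 0\<^sub>v nr"
      using eq[OF that] M by auto
    finally show ?thesis .
  qed
  then have sub: "w ` U \<subseteq> mat_kernel M"
    by (auto intro: mat_kernelI[OF M] w_carrier)
  have "lin_indpt (w ` U)"
  proof (rule Ker.finite_lin_indpt2)
    fix a assume lc: "Ker.lincomb a (w ` U) = 0\<^sub>v nc"
    show "\<forall>y\<in>w ` U. a y = 0"
    proof safe
      fix u assume u: "u \<in> U"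
      have "0 = Ker.lincomb a (w ` U) $ u"
        using lc u U by auto
      also have "\<dots> = (\<Sum>x\<in>w ` U. a x * x $ u)"
        using u U by (intro lincomb_index sub) auto
      also have "\<dots> = (\<Sum>y\<in>U. if y = u then a (w y) else 0)"
        unfolding sum.reindex[OF inj] o_def by (intro sum.cong) (auto simp: w_index u)
      also have "\<dots> = a (w u)"
        using u finU by simp
      finally show "a (w u) = 0" by simp
    qed
  qed (use finU sub in auto)
  moreover have "Ker.fin_dim"
    using kernel_basis_exists[OF M] unfolding Ker.fin_dim_def Ker.basis_def by auto
  ultimately have "card (w ` U) \<le> dim"
    using sub by (intro Ker.li_le_dim(2)) auto
  then show ?thesis
    using card_image[OF inj] by simp
qed

text \<open>
  Each product in the Leibniz expansion takes one factor from every row in \<open>I\<close>.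
\<close>

lemma power_card_dvd_det:
  fixes M :: "'a :: comm_ring_1 mat"
  assumes M: "M \<in> carrier_mat n n" and I: "I \<subseteq> {..<n}"
    and dvd: "\<And>i j. i \<in> I \<Longrightarrow> j < n \<Longrightarrow> p dvd M $$ (i, j)"
  shows "p ^ card I dvd det M"
  unfolding det_def'[OF M]
proof (intro dvd_sum dvd_mult)
  fix \<pi> assume "\<pi> \<in> {\<pi>. \<pi> permutes {0..<n}}"
  then have \<pi>: "\<pi> i < n" if "i < n" for i
    using that permutes_in_image[of \<pi> "{0..<n}" i] by auto
  have I': "I \<subseteq> {0..<n}"
    using I by auto
  have "p ^ card I = (\<Prod>i\<in>I. p)"
    by simp
  also have "\<dots> dvd (\<Prod>i\<in>I. M $$ (i, \<pi> i))"
    using I by (intro prod_dvd_prod dvd \<pi>) auto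
  also have "\<dots> dvd (\<Prod>i=0..<n. M $$ (i, \<pi> i))"
    by (rule prod_dvd_prod_subset[OF finite_atLeastLessThan I'])
  finally show "p ^ card I dvd (\<Prod>i=0..<n. M $$ (i, \<pi> i))" .
qed

text \<open>
  Let \<open>P\<close> be invertible such that \<open>C = P (A - e I)\<close> is in row echelon form. The number of zero rows
  of \<open>C\<close> is the geometric multiplicity of \<open>e\<close>, and \<open>P (X I - A) = (X - e) P - C\<close>. So \<open>X - e\<close> divides
  that many rows of \<open>P (X I - A)\<close>, whose determinant is the characteristic polynomial up to
  the unit \<open>det P\<close>.
\<close>

lemma kernel_dim_le_order_char_poly:
  fixes A :: "'a :: field mat"
  assumes A: "A \<in> carrier_mat n n"
  shows "kernel_dim (char_matrix A e) \<le> Polynomial.order e (char_poly A)"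
proof -
  interpret const: comm_ring_hom "\<lambda>a :: 'a. [:a:]"
    by unfold_locales (auto simp: one_pCons)
  let ?M = "char_matrix A e" and ?c = "map_mat (\<lambda>a. [:a:])"
  define C where "C = gauss_jordan_single ?M"
  have M: "?M \<in> carrier_mat n n"
    using A by simp
  obtain P Q where C: "C \<in> carrier_mat n n" "row_echelon_form C" "C = P * ?M"
    and P: "P \<in> carrier_mat n n" "Q \<in> carrier_mat n n" "P * Q = 1\<^sub>m n"
    using gauss_jordan_single[OF M C_def[symmetric]] by blast
  define Z where "Z = {i. i < n \<and> row C i = 0\<^sub>v n}"
  have "kernel_dim ?M = n - card {i. i < n \<and> row C i \<noteq> 0\<^sub>v n}"
    using find_base_vectors(5)[OF C(2,1)] M by (simp add: kernel_dim_code C_def[symmetric])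
  moreover have "card Z + card {i. i < n \<and> row C i \<noteq> 0\<^sub>v n} = n"
  proof -
    have "card Z + card {i. i < n \<and> row C i \<noteq> 0\<^sub>v n} = card (Z \<union> {i. i < n \<and> row C i \<noteq> 0\<^sub>v n})"
      by (rule card_Un_disjoint[symmetric]) (auto simp: Z_def)
    also have "Z \<union> {i. i < n \<and> row C i \<noteq> 0\<^sub>v n} = {..<n}"
      by (auto simp: Z_def)
    finally show ?thesis by simp
  qed
  ultimately have Z: "card Z = kernel_dim ?M" by simp
  have cpm: "char_poly_matrix A \<in> carrier_mat n n"
    using A by simp
  have "[:- e, 1:] dvd (?c P * char_poly_matrix A) $$ (i, j)" if i: "i \<in> Z" and j: "j < n" for i j
  proof -
    have "i < n"
      using i by (simp add: Z_def)
    have "(\<Sum>k<n. P $$ (i, k) * ?M $$ (k, j)) = C $$ (i, j)"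
      using C(3) P(1) M \<open>i < n\<close> j by (simp add: scalar_prod_def atLeast0LessThan)
    also have "\<dots> = row C i $ j"
      using C(1) \<open>i < n\<close> j by simp
    also have "\<dots> = 0"
      using i j by (simp add: Z_def)
    finally have zero: "(\<Sum>k<n. P $$ (i, k) * ?M $$ (k, j)) = 0" .
    have "(?c P * char_poly_matrix A) $$ (i, j) =
        (\<Sum>k<n. [:P $$ (i, k):] * char_poly_matrix A $$ (k, j))"
      using P(1) cpm \<open>i < n\<close> j by (simp add: scalar_prod_def atLeast0LessThan)
    also have "\<dots> = (\<Sum>k<n. (if k = j then [:P $$ (i, k):] * [:- e, 1:] else 0)
        - [:P $$ (i, k) * ?M $$ (k, j):])"
      using A j by (intro sum.cong) (auto simp: char_poly_matrix_def char_matrix_def algebra_simps)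
    also have "\<dots> = [:P $$ (i, j):] * [:- e, 1:] - [:\<Sum>k<n. P $$ (i, k) * ?M $$ (k, j):]"
      using j by (simp add: sum_subtractf const.hom_sum del: mult_pCons_left mult_pCons_right)
    also have "\<dots> = [:P $$ (i, j):] * [:- e, 1:]"
      by (simp add: zero)
    finally show ?thesis
      by (metis dvd_triv_right)
  qed
  then have "[:- e, 1:] ^ card Z dvd det (?c P * char_poly_matrix A)"
    using P(1) cpm by (intro power_card_dvd_det[of _ n]) (auto simp: Z_def)
  also have "\<dots> = [:det P:] * char_poly A"
    using P(1) cpm by (subst det_mult[of _ n]) (auto simp: char_poly_def)
  also have "\<dots> dvd char_poly A"
  proof -
    have "det P * det Q = 1"
      using P det_mult[OF P(1,2)] by simp
    then have "det P \<noteq> 0" by auto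
    then show ?thesis
      by (simp add: smult_dvd_iff)
  qed
  finally have "[:- e, 1:] ^ kernel_dim ?M dvd char_poly A"
    by (simp add: Z)
  moreover have "char_poly A \<noteq> 0"
    using degree_monic_char_poly[OF A] by auto
  ultimately show ?thesis
    by (metis order_max)
qed

lemma eigenvalue_if_kernel_dim_char_matrix_pos:
  fixes A :: "'a :: field mat"
  assumes A: "A \<in> carrier_mat n n" and pos: "0 < kernel_dim (char_matrix A e)"
  shows "eigenvalue A e"
proof -
  have "Polynomial.order e (char_poly A) \<noteq> 0"
    using kernel_dim_le_order_char_poly[OF A, of e] pos by simp
  then show ?thesis
    using eigenvalue_root_char_poly[OF A] by (metis order_0I)
qed

lemma mat_inverse_mat_diag:
  fixes f :: "nat \<Rightarrow> 'a :: field"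
  assumes f: "\<And>i. i < n \<Longrightarrow> f i \<noteq> 0"
  shows "mat_inverse (mat_diag n f) = Some (mat_diag n (\<lambda>i. inverse (f i)))"
proof -
  let ?D = "mat_diag n f" and ?E = "mat_diag n (\<lambda>i. inverse (f i))"
  have mat_diag_eq_one: "mat_diag n g = 1\<^sub>m n" if "\<And>i. i < n \<Longrightarrow> g i = 1" for g :: "nat \<Rightarrow> 'a"
    using that by (intro eq_matI) (auto simp: mat_diag_def)
  have one: "?D * ?E = 1\<^sub>m n" "?E * ?D = 1\<^sub>m n"
    using f by (simp_all add: mat_diag_eq_one)
  show ?thesis
  proof (cases "mat_inverse ?D")
    case None
    have "?D \<in> Units (ring_mat TYPE('a) n ())"
      using one by (auto simp: Units_def ring_mat_def intro!: bexI[of _ ?E])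
    with mat_inverse(1)[OF mat_diag_dim None, of "()"] show ?thesis by blast
  next
    case (Some B)
    from mat_inverse(2)[OF mat_diag_dim this] have B: "B * ?D = 1\<^sub>m n" "B \<in> carrier_mat n n"
      by auto
    have "B = B * (?D * ?E)"
      using B(2) one by simp
    also have "\<dots> = (B * ?D) * ?E"
      by (rule assoc_mult_mat[symmetric, OF B(2) mat_diag_dim mat_diag_dim])
    also have "\<dots> = ?E"
      using left_mult_one_mat[OF mat_diag_dim] by (simp only: B(1))
    finally show ?thesis
      using Some by simp
  qed
qed

section \<open>Degrees and normalized adjacency in threshold graphs\<close>

lemma normalized_adjacency_matrix_eq:
  assumes pos: "\<And>u. u < card (pverts G) \<Longrightarrow> out_degree (with_proj G) (Suc u) \<noteq> 0"
  shows "normalized_adjacency_matrix G = mat (card (pverts G)) (card (pverts G))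
    (\<lambda>(i, j). if (Suc i, Suc j) \<in> parcs G then 1 / real (out_degree (with_proj G) (Suc i)) else 0)"
  unfolding normalized_adjacency_matrix_def degree_matrix_def
  by (subst mat_inverse_mat_diag, use pos in simp,
      simp, subst mat_diag_mult_left[of _ _ "card (pverts G)"])
    (auto simp: adjacency_matrix_def Let_def divide_inverse)

lemma parcs_threshold_graph:
  "(Suc u, Suc v) \<in> parcs (threshold_graph b) \<longleftrightarrow>
     u < length b \<and> v < length b \<and> u \<noteq> v \<and> b ! max u v"
  by (auto simp: threshold_graph_def parcs_threshold_graph_upto max_def)

lemma out_degree_threshold_graph:
  assumes "u < length b"
  shows "out_degree (with_proj (threshold_graph b)) (Suc u) =
    card {v. v < length b \<and> v \<noteq> u \<and> b ! max u v}"
proof -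
  have "out_arcs (with_proj (threshold_graph b)) (Suc u) =
      (\<lambda>v. (Suc u, Suc v)) ` {v. v < length b \<and> v \<noteq> u \<and> b ! max u v}"
    (is "?L = ?R")
  proof (rule Set.set_eqI)
    fix e
    show "e \<in> ?L \<longleftrightarrow> e \<in> ?R"
    proof (cases e)
      case (Pair x y)
      show ?thesis
      proof (cases y)
        case 0
        with Pair show ?thesis
          by (auto simp: threshold_graph_def parcs_threshold_graph_upto)
      next
        case (Suc v)
        with Pair assms show ?thesis
          by (auto simp: parcs_threshold_graph)
      qed
    qed
  qed
  then show ?thesis
    unfolding out_degree_def by (simp add: card_image inj_on_def)
qed

text \<open>
  A vertex added as dominating, together with its neighbours, makes up all dominating vertices
  and those isolated additions that came before it.
\<close>

lemma Suc_out_degree_dominating_vertex: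
  assumes u: "u < length b" "b ! u"
  shows "Suc (out_degree (with_proj (threshold_graph b)) (Suc u)) =
    count_list b True + count_list (take u b) False"
proof -
  let ?N = "{v. v < length b \<and> v \<noteq> u \<and> b ! max u v}"
  have "Suc (card ?N) = card (insert u ?N)"
    by simp
  also have "insert u ?N = {v. v < length b \<and> b ! v} \<union> {v. v < u \<and> \<not> b ! v}"
    using u by (auto simp: max_def not_le)
  also have "card \<dots> = card {v. v < length b \<and> b ! v} + card {v. v < u \<and> \<not> b ! v}"
    by (rule card_Un_disjoint) auto
  also have "{v. v < u \<and> \<not> b ! v} = {v. v < length (take u b) \<and> take u b ! v = False}"
    using u by auto
  finally show ?thesis
    using u by (simp add: out_degree_threshold_graph count_list_eq_length_filter length_filter_conv_card)
qed

text \<open>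
  A final one makes the last vertex adjacent to all others, so with at least two vertices no degree
  vanishes and the degree matrix is invertible.
\<close>

lemma normalized_adjacency_matrix_threshold_graph:
  assumes "2 \<le> length b" "last b"
  shows "normalized_adjacency_matrix (threshold_graph b) = mat (length b) (length b)
    (\<lambda>(i, j). if i \<noteq> j \<and> b ! max i j
       then 1 / real (out_degree (with_proj (threshold_graph b)) (Suc i)) else 0)"
proof -
  let ?G = "threshold_graph b"
  have n: "card (pverts ?G) = length b"
    by (simp add: threshold_graph_def pverts_threshold_graph_upto)
  have "b ! (length b - 1)"
    using assms last_conv_nth[of b] by fastforce
  have "out_degree (with_proj ?G) (Suc u) \<noteq> 0" if u: "u < length b" for u
  proof -
    define v where "v = (if u = length b - 1 then 0 else length b - 1)"
    have "v \<in> {v. v < length b \<and> v \<noteq> u \<and> b ! max u v}"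
      using assms(1) \<open>b ! (length b - 1)\<close> u by (auto simp: v_def max_def split: if_splits)
    then show ?thesis
      using u by (auto simp: out_degree_threshold_graph)
  qed
  then show ?thesis
    by (subst normalized_adjacency_matrix_eq)
      (auto simp: n parcs_threshold_graph intro!: cong_mat)
qed

section \<open>Runs of ones are classes of twins\<close>

text \<open>
  Adjacency of \<open>i\<close> and \<open>u\<close> is decided by the later of the two. For \<open>u\<close> in a run of ones, either
  \<open>i\<close> lies beyond the run and is itself the later one, or the later one carries a one. So the answer
  does not depend on \<open>u\<close>. The row-dependent
  factor \<open>1 / deg i\<close> is the same in all columns, and at \<open>i = u\<close> the shift by \<open>1 / d\<close> supplies it.
\<close>

lemma kernel_dim_char_matrix_run_of_ones:
  fixes pre post :: "bool list" and m :: nat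
  defines "b \<equiv> pre @ replicate m True @ post"
  defines "d \<equiv> real (count_list b True) + real (count_list pre False) - 1"
  assumes m: "2 \<le> m" and last: "last b"
  shows "m - 1 \<le> kernel_dim (char_matrix (normalized_adjacency_matrix (threshold_graph b)) (- 1 / d))"
proof -
  let ?A = "normalized_adjacency_matrix (threshold_graph b)"
  let ?deg = "\<lambda>i. real (out_degree (with_proj (threshold_graph b)) (Suc i))"
  let ?M = "char_matrix ?A (- 1 / d)"
  define a where "a = length pre"
  have len: "length b = a + m + length post"
    by (simp add: b_def a_def)
  have A: "?A = mat (length b) (length b) (\<lambda>(i, j). if i \<noteq> j \<and> b ! max i j then 1 / ?deg i else 0)"
    using m len last by (intro normalized_adjacency_matrix_threshold_graph) auto
  then have carr: "?A \<in> carrier_mat (length b) (length b)"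
    by simp
  have M_carrier: "?M \<in> carrier_mat (length b) (length b)"
    using carr by (rule char_matrix_closed)
  have one: "b ! u" if "a \<le> u" "u < a + m" for u
    using that by (auto simp: b_def a_def nth_append)
  have deg: "?deg u = d" if u: "a \<le> u" "u < a + m" for u
  proof -
    have "count_list (take u b) False = count_list pre False"
      using u by (simp add: b_def a_def count_list_eq_length_filter)
    with Suc_out_degree_dominating_vertex[of u b] one[OF u] u len show ?thesis
      unfolding d_def by linarith
  qed
  have M: "?M $$ (i, u) = (if b ! max i u then 1 / ?deg i else 0)"
    if "i < length b" "a \<le> u" "u < a + m" for i u
    using that len one[of u] deg[of u] by (auto simp: A char_matrix_def)
  have "card {Suc a..<a + m} \<le> kernel_dim ?M"
  proof (rule card_equal_columns_le_kernel_dim[of _ "length b" "length b" _ a])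
    fix u assume u: "u \<in> {Suc a..<a + m}"
    show "col ?M u = col ?M a"
    proof (intro eq_vecI)
      fix i assume "i < dim_vec (col ?M a)"
      then have i: "i < length b"
        using M_carrier by simp
      have "b ! max i u = b ! max i a"
        using one[of "max i u"] one[of "max i a"] u by (cases "i \<le> u") (auto simp: max_def)
      then show "col ?M u $ i = col ?M a $ i"
        using i u m len M_carrier M[of i u] M[of i a] by simp
    qed simp
  qed (use len m M_carrier in auto)
  then show ?thesis by simp
qed

section \<open>Block strings\<close>

lemma block_string_append:
  assumes "i \<in> {1..k}"
  obtains pre post where
    "block_string k s t = pre @ replicate (t i) True @ post"
    "count_list pre False = (\<Sum>j=1..i. s j)"
proof -
  let ?B = "\<lambda>j. replicate (s j) False @ replicate (t j) True"
  let ?pre = "concat (map ?B [1..<i])"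
  have split: "[1..<Suc k] = [1..<i] @ i # [Suc i..<Suc k]"
    using assms upt_add_eq_append[of 1 i "Suc k - i"] by (simp add: upt_conv_Cons)
  have "count_list (concat (map ?B [1..<j])) False = (\<Sum>l=1..<j. s l)" for j
    by (induction j) (auto simp: count_list_eq_length_filter atLeastLessThanSuc)
  then have "count_list (?pre @ replicate (s i) False) False = (\<Sum>j=1..i. s j)"
    using assms by (simp add: count_list_eq_length_filter sum.last_plus add.commute)
  moreover have "block_string k s t = (?pre @ replicate (s i) False) @ replicate (t i) True @
      concat (map ?B [Suc i..<Suc k])"
    unfolding block_string_def split by simp
  ultimately show ?thesis using that by blast
qed

lemma count_True_block_string: "count_list (block_string k s t) True = (\<Sum>j=1..k. t j)"
  by (induction k) (simp_all add: block_string_def count_list_eq_length_filter)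

lemma last_block_string:
  assumes "1 \<le> k" "0 < t k"
  shows "last (block_string k s t)"
  using assms by (cases k) (simp_all add: block_string_def)

theorem lemma2p1:
  fixes k :: nat and s t :: "nat \<Rightarrow> nat" and \<Gamma> :: "nat pair_pre_digraph"
  assumes "1 \<le> k"
    and "\<forall>j\<in>{1..k}. 0 < s j \<and> 0 < t j"
    and "\<Gamma> = threshold_graph (block_string k s t)"
    and "Digraph_Component.connected (with_proj \<Gamma>)"
  shows "\<forall>i\<in>{1..k}. 1 < t i \<longrightarrow>
    (let A = normalized_adjacency_matrix \<Gamma>;
         ev = - 1 / (real (\<Sum>j=1..k. t j) + real (\<Sum>j=1..i. s j) - 1)
     in eigenvalue A ev \<and>
        t i - 1 \<le> Polynomial.order ev (char_poly A) \<and>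
        t i - 1 \<le> kernel_dim (char_matrix A ev))"
proof (intro ballI impI)
  fix i assume i: "i \<in> {1..k}" and ti: "1 < t i"
  let ?b = "block_string k s t"
  define A where "A = normalized_adjacency_matrix \<Gamma>"
  define ev where "ev = - 1 / (real (\<Sum>j=1..k. t j) + real (\<Sum>j=1..i. s j) - 1)"
  obtain pre post where b: "?b = pre @ replicate (t i) True @ post"
    and pre: "count_list pre False = (\<Sum>j=1..i. s j)"
    by (rule block_string_append[OF i])
  have last: "last ?b"
    using assms(1,2) by (intro last_block_string) auto
  have len: "2 \<le> length ?b"
    using ti by (simp add: b)
  have "A \<in> carrier_mat (length ?b) (length ?b)"
    unfolding A_def assms(3) normalized_adjacency_matrix_threshold_graph[OF len last] by simp
  moreover have kd: "t i - 1 \<le> kernel_dim (char_matrix A ev)"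
    using kernel_dim_char_matrix_run_of_ones[of "t i" pre post, folded b] ti last
    by (simp only: A_def ev_def assms(3) pre count_True_block_string)
  ultimately have "eigenvalue A ev" "t i - 1 \<le> Polynomial.order ev (char_poly A)"
    using ti kernel_dim_le_order_char_poly[of A _ ev]
    by (auto intro: eigenvalue_if_kernel_dim_char_matrix_pos order.trans)
  with kd show "let A = normalized_adjacency_matrix \<Gamma>;
         ev = - 1 / (real (\<Sum>j=1..k. t j) + real (\<Sum>j=1..i. s j) - 1)
     in eigenvalue A ev \<and>
        t i - 1 \<le> Polynomial.order ev (char_poly A) \<and>
        t i - 1 \<le> kernel_dim (char_matrix A ev)"
    unfolding Let_def A_def ev_def by blast
qed

end
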